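(* Let $\mathcal{D}=(d_n)_{n\ge1}$ with $d_n=2^{2^n}$. Then the set of real numbers $\alpha$ such that $$\liminf_{q\to\infty}\ q\cdot \log\log q\cdot \log\log\log q\cdot |q|_{\mathcal{D}}\cdot \|q\alpha\|>0$$ has Hausdorff dimension equal to $1$.
   Context: $\|x\|$ denotes the distance from $x$ to the nearest integer. $D_0:=1$, $D_n:=\prod_{k=1}^n d_k$, and for $q\in\mathbb{Z}$, $|q|_{\mathcal{D}}:=\inf\{D_n^{-1}: n\ge0,\ q\in D_n\mathbb{Z}\}$. The $\liminf$ is over positive integers $q$. *)

theory Defs
  imports "HOL-Analysis.Analysis"
begin

(* The cost diam(U)^s of a covering set, with the conventions diam({})^s = 0 for all s and
   diam(U)^0 = 1 for nonempty U.  The case distinction is needed because 0 powr 0 = 0. *)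
definition hausdorff_cost :: "real \<Rightarrow> 'a::metric_space set \<Rightarrow> ennreal" where
  "hausdorff_cost s U =
     (if U = {} then 0 else if s = 0 then 1 else ennreal (diameter U powr s))"

(* Boundedness is required explicitly since diameter is real-valued, hence
   unspecified on unbounded sets. *)
definition hausdorff_covers :: "real \<Rightarrow> 'a::metric_space set \<Rightarrow> (nat \<Rightarrow> 'a set) set" where
  "hausdorff_covers \<delta> S =
     {U. S \<subseteq> (\<Union>i. U i) \<and> (\<forall>i. bounded (U i) \<and> diameter (U i) \<le> \<delta>)}"

definition hausdorff_premeasure :: "real \<Rightarrow> real \<Rightarrow> 'a::metric_space set \<Rightarrow> ennreal" where
  "hausdorff_premeasure s \<delta> S = (INF U\<in>hausdorff_covers \<delta> S. \<Sum>i. hausdorff_cost s (U i))"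

definition hausdorff_measure :: "real \<Rightarrow> 'a::metric_space set \<Rightarrow> ennreal" where
  "hausdorff_measure s S = (SUP \<delta>\<in>{0<..}. hausdorff_premeasure s \<delta> S)"

definition hausdorff_dimension :: "'a::metric_space set \<Rightarrow> ennreal" where
  "hausdorff_dimension S = Inf {ennreal s |s. 0 \<le> s \<and> hausdorff_measure s S = 0}"

definition dist_nearest_int :: "real \<Rightarrow> real" where
  "dist_nearest_int x = \<bar>x - of_int (round x)\<bar>"

definition partial_prod :: "(nat \<Rightarrow> nat) \<Rightarrow> nat \<Rightarrow> nat" where
  "partial_prod d n = (\<Prod>k=1..n. d k)"

definition pseudo_abs :: "(nat \<Rightarrow> nat) \<Rightarrow> int \<Rightarrow> real" where
  "pseudo_abs d q = Inf {inverse (real (partial_prod d n)) |n. int (partial_prod d n) dvd q}"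

end

theory Submission
  imports Defs "HOL-Library.Discrete_Functions" "HOL-Real_Asymp.Real_Asymp"
begin

text \<open>
  The partial products are \<open>D\<^sub>n = 4 ^ (2 ^ n - 1)\<close>.  For fixed \<open>n\<close> and \<open>j\<close>, the fractions \<open>p / (D\<^sub>n q)\<close>
  with \<open>2 ^ j \<le> q < 2 ^ (j + 1)\<close> are \<open>4 ^ (- t)\<close>-separated, where \<open>t = 2 ^ n + j\<close>, and about \<open>log t\<close>
  pairs \<open>(n, j)\<close> share the same \<open>t\<close>.  A real number belongs to the set as soon as, for all large \<open>t\<close>,
  it has distance more than \<open>4 ^ (- (t + m))\<close> from all these fractions, where \<open>4 ^ m\<close> is of
  order \<open>log t \<cdot> log log t\<close>.  In the tree of 4-adic intervals, avoiding the neighbourhoods of scale \<open>t\<close>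
  removes, at level \<open>t + m\<close>, only \<open>O(log t)\<close> descendants of each surviving interval of level \<open>t\<close>.  So
  if \<open>N t\<close> intervals survive at level \<open>t\<close>, then \<open>N (t + 1) \<ge> (4 - 2 / m) N t\<close>, inductively.

  This counting leaves enough room for removing, in addition, all intervals that meet some member of
  a cover with small \<open>s\<close>-dimensional cost, \<open>s < 1\<close>.  By compactness a point survives
  everything: it lies in the set, but in no member of the cover.  Hence the set has no such cover.
\<close>

section \<open>Survivors in the tree of 4-adic intervals\<close>

definition cell :: "nat \<Rightarrow> nat \<Rightarrow> real set" where
  "cell t b = {real b / 4 ^ t .. (real b + 1) / 4 ^ t}"

text \<open>A node of level \<open>t\<close> is an index \<open>b\<close> whose parent is
  \<open>b div 4\<close>, and the root is the unit interval. The set \<open>G 0\<close> is never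
  consulted, so a limit point is only known to avoid the sets \<open>G (Suc t)\<close>.\<close>

primrec survivors :: "(nat \<Rightarrow> real set) \<Rightarrow> nat \<Rightarrow> nat set" where
  "survivors G 0 = {0}"
| "survivors G (Suc t) = {b. b div 4 \<in> survivors G t \<and> cell (Suc t) b \<inter> G (Suc t) = {}}"

lemma card_div4_vimage:
  assumes "finite A"
  shows "finite {b::nat. b div 4 \<in> A}" "card {b::nat. b div 4 \<in> A} = 4 * card A"
proof -
  have eq: "{b::nat. b div 4 \<in> A} = (\<lambda>(a, r). 4 * a + r) ` (A \<times> {..<4})"
  proof (intro equalityI subsetI)
    fix b assume "b \<in> {b. b div 4 \<in> A}"
    then show "b \<in> (\<lambda>(a, r). 4 * a + r) ` (A \<times> {..<4})"
      by (intro image_eqI[of _ _ "(b div 4, b mod 4)"]) auto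
  qed auto
  have inj: "inj_on (\<lambda>(a, r). 4 * a + r) (A \<times> {..<4::nat})"
    by (intro inj_onI) (clarsimp; presburger)
  show "finite {b::nat. b div 4 \<in> A}" unfolding eq using assms by simp
  show "card {b::nat. b div 4 \<in> A} = 4 * card A"
    unfolding eq by (subst card_image[OF inj]) (simp add: card_cartesian_product)
qed

lemma finite_survivors: "finite (survivors G t)"
proof (induction t)
  case (Suc t)
  show ?case
    by (rule finite_subset[OF _ card_div4_vimage(1)[OF Suc]]) auto
qed simp

lemma survivors_ancestor: "b \<in> survivors G (t + i) \<Longrightarrow> b div 4 ^ i \<in> survivors G t"
proof (induction i arbitrary: b)
  case (Suc i)
  then have "b div 4 \<in> survivors G (t + i)" by simp
  from Suc.IH[OF this] show ?case by (simp add: div_mult2_eq)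
qed simp

lemma cell_subset_ancestor: "cell (t + i) b \<subseteq> cell t (b div 4 ^ i)"
proof -
  define a :: nat where "a = b div 4 ^ i"
  have "a * 4 ^ i \<le> b" unfolding a_def by simp
  then have "real (a * 4 ^ i) \<le> real b" by (rule of_nat_mono)
  then have 1: "real a * 4 ^ i \<le> real b" by simp
  have "b + 1 \<le> a * 4 ^ i + 4 ^ i"
    unfolding a_def using dividend_less_div_times[of "4 ^ i" b] by simp
  then have "real (b + 1) \<le> real (a * 4 ^ i + 4 ^ i)" by (rule of_nat_mono)
  then have 2: "real b + 1 \<le> (real a + 1) * 4 ^ i" by (simp add: distrib_right)
  have "real a / 4 ^ t = real a * 4 ^ i / 4 ^ (t + i)"
    and "(real a + 1) / 4 ^ t = (real a + 1) * 4 ^ i / 4 ^ (t + i)"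
    by (simp_all add: power_add)
  with 1 2 have "real a / 4 ^ t \<le> real b / 4 ^ (t + i)" "(real b + 1) / 4 ^ (t + i) \<le> (real a + 1) / 4 ^ t"
    by (simp_all add: divide_right_mono)
  then show ?thesis
    unfolding cell_def a_def by auto
qed

lemma card_survivors_Suc:
  "4 * card (survivors G t) \<le> card (survivors G (Suc t)) +
     card {b. b div 4 \<in> survivors G t \<and> cell (Suc t) b \<inter> G (Suc t) \<noteq> {}}" (is "_ \<le> card ?S + card ?B")
proof -
  have eq: "{b. b div 4 \<in> survivors G t} = ?S \<union> ?B" by auto
  have "4 * card (survivors G t) = card (?S \<union> ?B)"
    unfolding eq[symmetric] by (rule card_div4_vimage(2)[OF finite_survivors, symmetric])
  also have "\<dots> \<le> card ?S + card ?B" by (rule card_Un_le)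
  finally show ?thesis .
qed

text \<open>Cells are closed and each level has finitely many, so the union of the survivors of a
  level is compact; ancestors of survivors survive, so these unions are nested. A point common to
  all of them lies, at each level, in a cell that misses \<open>G\<close>.\<close>

lemma survivors_limit_point:
  assumes "\<And>t. survivors G t \<noteq> {}"
  obtains x where "\<And>t. x \<notin> G (Suc t)"
proof -
  define F where "F t = (\<Union>b\<in>survivors G t. cell t b)" for t
  have cpt: "compact (F t)" for t
    unfolding F_def using finite_survivors by (intro compact_UN) (auto simp: cell_def)
  have ne: "F t \<noteq> {}" for t
    using assms[of t] unfolding F_def cell_def by (simp add: divide_right_mono)
  have nest: "F n \<subseteq> F m" if "m \<le> n" for m n
  proof -
    obtain i where i: "n = m + i" using le_Suc_ex[OF \<open>m \<le> n\<close>] by auto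
    show ?thesis
    proof
      fix x assume "x \<in> F n"
      then obtain b where "b \<in> survivors G (m + i)" "x \<in> cell (m + i) b"
        unfolding F_def i by auto
      then have "b div 4 ^ i \<in> survivors G m" "x \<in> cell m (b div 4 ^ i)"
        using cell_subset_ancestor survivors_ancestor by auto
      then show "x \<in> F m" unfolding F_def by blast
    qed
  qed
  have "\<Inter> (range F) \<noteq> {}"
    using compact_nest[OF cpt ne nest] by simp
  then obtain x where x: "\<And>t. x \<in> F t" by auto
  have "x \<notin> G (Suc t)" for t
  proof -
    obtain b where "b \<in> survivors G (Suc t)" "x \<in> cell (Suc t) b"
      using x[of "Suc t"] unfolding F_def by blast
    then show ?thesis by auto
  qed
  then show thesis by (rule that)
qed

section \<open>Packing bounds for cells and for separated points\<close>

lemma card_nat_real_window: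
  fixes c :: real
  shows "finite {b::nat. c \<le> real b \<and> real b \<le> c + 3}"
    and "card {b::nat. c \<le> real b \<and> real b \<le> c + 3} \<le> 4"
proof -
  have sub: "int ` {b::nat. c \<le> real b \<and> real b \<le> c + 3} \<subseteq> {\<lceil>c\<rceil>..\<lceil>c\<rceil> + 3}"
    by (auto simp: ceiling_le_iff) linarith
  show "finite {b::nat. c \<le> real b \<and> real b \<le> c + 3}"
    by (rule finite_imageD[OF finite_subset[OF sub]]) auto
  have "card (int ` {b::nat. c \<le> real b \<and> real b \<le> c + 3}) \<le> card {\<lceil>c\<rceil>..\<lceil>c\<rceil> + 3}"
    by (rule card_mono[OF _ sub]) simp
  then show "card {b::nat. c \<le> real b \<and> real b \<le> c + 3} \<le> 4"
    by (subst (asm) card_image) auto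
qed

lemma card_cells_meeting:
  fixes U :: "real set"
  assumes "U \<subseteq> cball x (1 / 4 ^ t)"
  shows "finite {b. cell t b \<inter> U \<noteq> {}}" "card {b. cell t b \<inter> U \<noteq> {}} \<le> 4"
proof -
  \<comment> \<open>In units of the cell length, the meeting point is within 1 of
    \<open>x * 4 ^ t\<close>, and \<open>b\<close> is at most 1 below that point. This confines
    \<open>b\<close> to a window of length 3.\<close>
  have sub: "{b. cell t b \<inter> U \<noteq> {}} \<subseteq> {b. x * 4 ^ t - 2 \<le> real b \<and> real b \<le> (x * 4 ^ t - 2) + 3}"
  proof
    fix b assume "b \<in> {b. cell t b \<inter> U \<noteq> {}}"
    then obtain y where y: "y \<in> cell t b" "y \<in> U" by auto
    have "\<bar>x - y\<bar> \<le> 1 / 4 ^ t" using y(2) assms by (auto simp: dist_real_def)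
    then have "\<bar>x - y\<bar> * 4 ^ t \<le> 1" by (simp add: field_simps)
    then have "\<bar>x * 4 ^ t - y * 4 ^ t\<bar> \<le> 1" by (simp add: abs_mult flip: left_diff_distrib)
    moreover have "real b \<le> y * 4 ^ t" "y * 4 ^ t \<le> real b + 1"
      using y(1) by (auto simp: cell_def field_simps)
    ultimately have "x * 4 ^ t - 2 \<le> real b" "real b \<le> (x * 4 ^ t - 2) + 3" by linarith+
    then show "b \<in> {b. x * 4 ^ t - 2 \<le> real b \<and> real b \<le> (x * 4 ^ t - 2) + 3}" by simp
  qed
  show "finite {b. cell t b \<inter> U \<noteq> {}}"
    using finite_subset[OF sub card_nat_real_window(1)] .
  show "card {b. cell t b \<inter> U \<noteq> {}} \<le> 4"
    using card_mono[OF card_nat_real_window(1) sub] card_nat_real_window(2)[of "x * 4 ^ t - 2"] by linarith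
qed

text \<open>Dividing the window into steps of length \<open>h\<close> from \<open>c\<close>, two
  points with the same floor would be closer than \<open>h\<close>, and the floors lie in
  \<open>{0..3}\<close>.\<close>

lemma card_separated_window:
  fixes X :: "real set"
  assumes h: "h > 0" and sep: "\<And>x y. x \<in> X \<Longrightarrow> y \<in> X \<Longrightarrow> x \<noteq> y \<Longrightarrow> h \<le> \<bar>x - y\<bar>"
    and X: "X \<subseteq> {c..c + 3 * h}"
  shows "finite X" "card X \<le> 4"
proof -
  define f where "f x = \<lfloor>(x - c) / h\<rfloor>" for x
  have inj: "inj_on f X"
  proof (intro inj_onI, rule ccontr)
    fix x y assume "x \<in> X" "y \<in> X" and eq: "f x = f y" and "x \<noteq> y"
    then have "h \<le> \<bar>x - y\<bar>" using sep by blast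
    then have "1 \<le> \<bar>(x - y) / h\<bar>" using h by (simp add: field_simps)
    moreover have "(x - y) / h = (x - c) / h - (y - c) / h" by (simp add: diff_divide_distrib)
    ultimately show False using eq unfolding f_def by linarith
  qed
  have "f ` X \<subseteq> {0..3}"
  proof
    fix z assume "z \<in> f ` X"
    then obtain x where x: "x \<in> X" "z = f x" by auto
    then have "0 \<le> (x - c) / h" "(x - c) / h \<le> 3" using X h by (auto simp: field_simps)
    then show "z \<in> {0..3}" using x(2) unfolding f_def by (auto simp: floor_le_iff)
  qed
  then have "finite (f ` X)" "card (f ` X) \<le> card {0..3::int}"
    using card_mono[of "{0..3::int}" "f ` X"] by (auto intro: finite_subset)
  then show "finite X" "card X \<le> 4"
    using inj by (auto simp: card_image dest: finite_imageD)
qed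

section \<open>The gap function\<close>

text \<open>
  Here \<open>Suc (floor_log t)\<close> is the number of \<open>n\<close> with \<open>2 ^ n \<le> t\<close>.  The factor \<open>m\<close> on the left
  is what turns \<open>log log q\<close> into \<open>log log q \<cdot> log log log q\<close>; it pays for letting the loss
  of branching accumulate over the \<open>m\<close> levels during which a removal is pending.
\<close>

definition gap :: "nat \<Rightarrow> nat" where
  "gap t = (LEAST m. 0 < m \<and> 256 * Suc (floor_log t) * m \<le> 4 ^ m)"

lemma gap_ex: "\<exists>m. 0 < m \<and> 256 * Suc k * m \<le> (4::nat) ^ m"
proof -
  define m where "m = 256 * Suc k"
  have "m * m \<le> 2 ^ m * 2 ^ m"
    using less_exp[of m] by (intro mult_mono) auto
  also have "\<dots> = 4 ^ m" by (simp flip: power_mult_distrib)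
  finally have "m * m \<le> 4 ^ m" .
  moreover have "0 < m" by (simp add: m_def)
  ultimately show ?thesis unfolding m_def by blast
qed

lemma gap_pos: "0 < gap t"
  and gap_lower: "256 * Suc (floor_log t) * gap t \<le> 4 ^ gap t"
  using LeastI_ex[OF gap_ex[of "floor_log t"]] unfolding gap_def by blast+

lemma gap_le: "0 < m \<Longrightarrow> 256 * Suc (floor_log t) * m \<le> 4 ^ m \<Longrightarrow> gap t \<le> m"
  unfolding gap_def by (rule Least_le) (rule conjI)

text \<open>By minimality the predecessor of \<open>gap t\<close> violates the defining inequality,
  and one more factor 4 turns 256 into 1024. The predecessor is an admissible candidate because
  \<open>gap t = 1\<close> is impossible.\<close>

lemma gap_upper: "4 ^ gap t < 1024 * Suc (floor_log t) * gap t"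
proof -
  have "gap t \<noteq> 1" using gap_lower[of t] by auto
  then obtain m where m: "gap t = Suc m" "0 < m" using gap_pos[of t] by (cases "gap t") auto
  have "\<not> 256 * Suc (floor_log t) * m \<le> 4 ^ m" using gap_le[OF m(2), of t] m(1) by auto
  then have "4 ^ m < 256 * Suc (floor_log t) * m" by simp
  also have "\<dots> \<le> 256 * Suc (floor_log t) * Suc m" by (intro mult_left_mono) auto
  finally have "4 * 4 ^ m < 4 * (256 * Suc (floor_log t) * Suc m)" by (rule mult_strict_left_mono) simp
  also have "\<dots> = 1024 * Suc (floor_log t) * Suc m" by simp
  finally show ?thesis unfolding m(1) by simp
qed

text \<open>Since \<open>gap t < 2 ^ gap t\<close>, one factor \<open>2 ^ gap t\<close> of
  \<open>4 ^ gap t\<close> can be traded for the factor \<open>gap t\<close> in the upper bound.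
  Thus \<open>gap t\<close> is of order at most log log \<open>t\<close>.\<close>

lemma two_pow_gap_upper: "2 ^ gap t < 1024 * Suc (floor_log t)"
proof -
  have "2 ^ gap t * gap t \<le> 2 ^ gap t * 2 ^ gap t"
    using less_exp[of "gap t"] by (intro mult_left_mono) auto
  also have "\<dots> = 4 ^ gap t" by (simp flip: power_mult_distrib)
  also have "\<dots> < 1024 * Suc (floor_log t) * gap t" by (rule gap_upper)
  finally show ?thesis using mult_less_cancel2 by blast
qed

lemma gap_mono: "mono gap"
proof (rule monoI)
  fix s t :: nat assume "s \<le> t"
  then have "floor_log s \<le> floor_log t" by (simp add: floor_log_le_iff)
  then have "256 * Suc (floor_log s) * gap t \<le> 256 * Suc (floor_log t) * gap t"
    by (intro mult_right_mono) auto
  also have "\<dots> \<le> 4 ^ gap t" by (rule gap_lower)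
  finally show "gap s \<le> gap t" by (intro gap_le gap_pos)
qed

lemma floor_log_le_self: "floor_log t \<le> t"
proof (cases "t = 0")
  case False
  then have "2 ^ floor_log t \<le> t" by (simp add: floor_log_exp2_le)
  then show ?thesis using less_exp[of "floor_log t"] by linarith
qed simp

lemma gap_le_self:
  assumes "t \<ge> 20" shows "gap t \<le> t"
proof -
  have "1024 * Suc t \<le> 2 ^ t" using assms
    by (induction t rule: dec_induct) auto
  moreover have "1024 * Suc (floor_log t) \<le> 1024 * Suc t" using floor_log_le_self[of t] by simp
  ultimately have "2 ^ gap t < (2::nat) ^ t" using two_pow_gap_upper[of t] by linarith
  then show ?thesis using power_less_imp_less_exp[of 2 "gap t" t] by simp
qed

lemma gap_linear: "gap t \<le> 1024 * (t + 1)"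
proof -
  have "gap t < 2 ^ gap t" by (rule less_exp)
  also have "\<dots> < 1024 * Suc (floor_log t)" by (rule two_pow_gap_upper)
  also have "\<dots> \<le> 1024 * (t + 1)" using floor_log_le_self[of t] by simp
  finally show ?thesis by simp
qed

text \<open>Doubling \<open>t\<close> raises \<open>floor_log\<close> by one. This and the step from
  \<open>gap t\<close> to \<open>Suc (gap t)\<close> each at most double the left side of the
  defining inequality, while the right side gains a factor 4. So \<open>Suc (gap t)\<close> is
  admissible for \<open>u\<close>.\<close>

lemma gap_doubling:
  assumes "t \<ge> 1" "u < 2 * t" shows "gap u \<le> 2 * gap t"
proof -
  have "floor_log u \<le> floor_log (2 * t)" using assms by (simp add: floor_log_le_iff del: floor_log_twice)
  also have "\<dots> = Suc (floor_log t)" using assms by simp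
  finally have fl: "floor_log u \<le> Suc (floor_log t)" .
  have "256 * Suc (floor_log u) * Suc (gap t) \<le> 256 * (2 * Suc (floor_log t)) * (2 * gap t)"
    using fl gap_pos[of t] by (intro mult_mono) auto
  also have "\<dots> = 4 * (256 * Suc (floor_log t) * gap t)" by (simp only: ac_simps)
  also have "\<dots> \<le> 4 * 4 ^ gap t" using gap_lower[of t] by (rule mult_left_mono) simp
  finally have "gap u \<le> Suc (gap t)" by (intro gap_le) auto
  then show ?thesis using gap_pos[of t] by linarith
qed

lemma gap_at_top: "filterlim gap at_top sequentially"
  unfolding filterlim_at_top eventually_sequentially
proof
  fix Z :: nat
  show "\<exists>N. \<forall>n\<ge>N. Z \<le> gap n"
  proof (intro exI allI impI)
    \<comment> \<open>The threshold \<open>2 ^ (4 ^ Z)\<close> makes \<open>floor_log n\<close> at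
      least \<open>4 ^ Z\<close>, and \<open>floor_log n\<close> is at most
      \<open>4 ^ gap n\<close>.\<close>
    define Y :: nat where "Y = 4 ^ Z"
    fix n :: nat assume n: "n \<ge> 2 ^ (4 ^ Z)"
    then have "floor_log (2 ^ Y) \<le> floor_log n"
      unfolding Y_def by (rule floor_log_le_iff)
    then have "Y \<le> floor_log n" by simp
    also have "\<dots> \<le> 256 * Suc (floor_log n) * 1" by simp
    also have "\<dots> \<le> 256 * Suc (floor_log n) * gap n" using gap_pos[of n] by (intro mult_left_mono) auto
    also have "\<dots> \<le> 4 ^ gap n" by (rule gap_lower)
    finally show "Z \<le> gap n" unfolding Y_def by (simp add: power_le_imp_le_exp)
  qed
qed

section \<open>Removing the neighbourhoods of rationals\<close>

text \<open>Since \<open>4 ^ (2 ^ n - 1)\<close> is the partial product \<open>D\<^sub>n\<close>, these are the fractions \<open>p / (D\<^sub>n q)\<close>.\<close>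

definition approximants :: "nat \<Rightarrow> nat \<Rightarrow> real set" where
  "approximants n j = {of_int p / (4 ^ (2 ^ n - 1) * real q) | p q. 2 ^ j \<le> q \<and> q < 2 ^ Suc j}"

definition near_approximants :: "nat \<Rightarrow> real set" where
  "near_approximants t =
     (\<Union>n\<in>{n. 2 ^ n \<le> t}. \<Union>x\<in>approximants n (t - 2 ^ n). cball x (1 / 4 ^ (t + gap t)))"

text \<open>The common factor \<open>D\<close> enters only once: distinct fractions differ by at
  least \<open>1 / (D * q * q')\<close>, and \<open>q * q' \<le> 4 ^ Suc j\<close>.\<close>

lemma approximants_separated:
  assumes "x \<in> approximants n j" "y \<in> approximants n j" "x \<noteq> y"
  shows "1 / 4 ^ (2 ^ n + j) \<le> \<bar>x - y\<bar>"
proof -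
  define D :: real where "D = 4 ^ (2 ^ n - 1)"
  have D: "D > 0" unfolding D_def by simp
  obtain p q where x: "x = of_int p / (D * real q)" and q: "2 ^ j \<le> q" "q < 2 ^ Suc j"
    using assms(1) unfolding approximants_def D_def by blast
  obtain p' q' where y: "y = of_int p' / (D * real q')" and q': "2 ^ j \<le> q'" "q' < 2 ^ Suc j"
    using assms(2) unfolding approximants_def D_def by blast
  have pos: "0 < q" "0 < q'" using q(1) q'(1) by (auto intro: less_le_trans[of 0 "2 ^ j"])
  have diff: "x - y = of_int (p * int q' - p' * int q) / (D * (real q * real q'))"
    unfolding x y using D pos by (simp add: field_simps)
  have "p * int q' - p' * int q \<noteq> 0"
  proof
    assume "p * int q' - p' * int q = 0"
    then have "x - y = 0" unfolding diff by (simp only: of_int_0 div_0)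
    then show False using assms(3) by simp
  qed
  then have "1 \<le> \<bar>p * int q' - p' * int q\<bar>" by linarith
  then have one: "1 \<le> \<bar>of_int (p * int q' - p' * int q) :: real\<bar>" by linarith
  have "q * q' \<le> 2 ^ Suc j * 2 ^ Suc j"
    using q q' by (intro mult_mono) auto
  also have "\<dots> = 4 ^ Suc j" by (simp flip: power_mult_distrib)
  finally have "real (q * q') \<le> real (4 ^ Suc j)" by (rule of_nat_mono)
  then have "real q * real q' \<le> 4 ^ Suc j" by simp
  then have "D * (real q * real q') \<le> D * 4 ^ Suc j" using D by (intro mult_left_mono) auto
  also have "\<dots> = 4 ^ (2 ^ n - 1 + Suc j)" unfolding D_def by (simp only: power_add)
  also have "2 ^ n - 1 + Suc j = 2 ^ n + j" using one_le_power[of "2::nat" n] by linarith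
  finally have "1 / 4 ^ (2 ^ n + j) \<le> 1 / (D * (real q * real q'))"
    using D pos by (intro divide_left_mono) auto
  also have "\<dots> \<le> \<bar>of_int (p * int q' - p' * int q)\<bar> / (D * (real q * real q'))"
    using one D pos by (intro divide_right_mono) auto
  also have "\<dots> = \<bar>x - y\<bar>" unfolding diff using D pos by (simp add: abs_mult)
  finally show ?thesis .
qed

text \<open>Each of the at most \<open>Suc (floor_log t)\<close> values of \<open>n\<close> has at
  most four relevant fractions, by separation, and the ball around each fraction meets at most four
  cells of level \<open>t + gap t\<close>.\<close>

lemma card_cells_near_approximants:
  fixes a :: nat
  assumes "t \<ge> 1"
  defines "B \<equiv> {b. b div 4 ^ gap t = a \<and> cell (t + gap t) b \<inter> near_approximants t \<noteq> {}}"
  shows "finite B" "card B \<le> 16 * Suc (floor_log t)"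
proof -
  define h :: real where "h = 1 / 4 ^ t"
  define r :: real where "r = 1 / 4 ^ (t + gap t)"
  \<comment> \<open>The window is the cell \<open>a\<close> enlarged by \<open>h\<close> on both
    sides. As \<open>r \<le> h\<close>, it contains the centre of every ball that reaches the
    cell.\<close>
  define X where "X n = approximants n (t - 2 ^ n) \<inter> {real a / 4 ^ t - h..real a / 4 ^ t - h + 3 * h}" for n
  define C where "C x = {b. cell (t + gap t) b \<inter> cball x r \<noteq> {}}" for x
  define I where "I = {n. 2 ^ n \<le> t}"
  have h: "h > 0" "r \<le> h" unfolding h_def r_def by (auto simp: power_add field_simps)
  have I_sub: "I \<subseteq> {..floor_log t}"
  proof
    fix n assume "n \<in> I"
    then have "floor_log (2 ^ n) \<le> floor_log t" unfolding I_def by (intro floor_log_le_iff) simp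
    then show "n \<in> {..floor_log t}" by simp
  qed
  then have I: "finite I" "card I \<le> Suc (floor_log t)"
    using finite_subset card_mono[OF _ I_sub] by auto
  have X: "finite (X n)" "card (X n) \<le> 4" if "n \<in> I" for n
  proof -
    have "2 ^ n + (t - 2 ^ n) = t" using that unfolding I_def by simp
    then have sep: "h \<le> \<bar>x - y\<bar>" if "x \<in> X n" "y \<in> X n" "x \<noteq> y" for x y
      using approximants_separated[of x n "t - 2 ^ n" y] that unfolding X_def h_def by simp
    show "finite (X n)" "card (X n) \<le> 4"
      using card_separated_window[of h "X n" "real a / 4 ^ t - h", OF h(1) sep] unfolding X_def by auto
  qed
  have C: "finite (C x)" "card (C x) \<le> 4" for x
    using card_cells_meeting[of "cball x r" x "t + gap t"] unfolding C_def r_def by auto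
  have sub: "B \<subseteq> (\<Union>n\<in>I. \<Union>x\<in>X n. C x)"
  proof
    fix b assume "b \<in> B"
    then obtain y where b: "b div 4 ^ gap t = a" and y: "y \<in> cell (t + gap t) b" "y \<in> near_approximants t"
      unfolding B_def by blast
    then obtain n x where n: "n \<in> I" and x: "x \<in> approximants n (t - 2 ^ n)" "y \<in> cball x r"
      unfolding near_approximants_def I_def r_def by blast
    have "y \<in> cell t a" using y(1) cell_subset_ancestor[of t "gap t" b] b by auto
    then have "real a / 4 ^ t \<le> y" "y \<le> real a / 4 ^ t + h"
      unfolding cell_def h_def by (auto simp: add_divide_distrib)
    moreover have "\<bar>x - y\<bar> \<le> h" using x(2) h(2) by (auto simp: dist_real_def)
    ultimately have "x \<in> X n" using x(1) unfolding X_def by auto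
    moreover have "b \<in> C x" using y(1) x(2) unfolding C_def by auto
    ultimately show "b \<in> (\<Union>n\<in>I. \<Union>x\<in>X n. C x)" using n by blast
  qed
  have fin: "finite (\<Union>n\<in>I. \<Union>x\<in>X n. C x)" using I X C by auto
  show "finite B" using finite_subset[OF sub fin] .
  have inner: "card (\<Union>x\<in>X n. C x) \<le> 16" if "n \<in> I" for n
  proof -
    have "card (\<Union>x\<in>X n. C x) \<le> (\<Sum>x\<in>X n. card (C x))" by (rule card_UN_le[OF X(1)[OF that]])
    also have "\<dots> \<le> of_nat (card (X n)) * 4" by (rule sum_bounded_above) (rule C)
    also have "\<dots> \<le> 4 * 4" using X(2)[OF that] by simp
    finally show ?thesis by simp
  qed
  have "card B \<le> card (\<Union>n\<in>I. \<Union>x\<in>X n. C x)" by (rule card_mono[OF fin sub])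
  also have "\<dots> \<le> (\<Sum>n\<in>I. card (\<Union>x\<in>X n. C x))" by (rule card_UN_le[OF I(1)])
  also have "\<dots> \<le> of_nat (card I) * 16" by (rule sum_bounded_above) (rule inner)
  also have "\<dots> \<le> 16 * Suc (floor_log t)" using I(2) by simp
  finally show "card B \<le> 16 * Suc (floor_log t)" .
qed

text \<open>The removed cells are grouped by their ancestors at level \<open>t\<close>, which are
  survivors. The loss at level \<open>t + gap t\<close> is thereby measured against the much smaller
  number of survivors at level \<open>t\<close>.\<close>

lemma card_survivors_near_approximants:
  assumes "t \<ge> 1" "Suc u = t + gap t"
  shows "finite {b. b div 4 \<in> survivors G u \<and> cell (Suc u) b \<inter> near_approximants t \<noteq> {}}"
    and "card {b. b div 4 \<in> survivors G u \<and> cell (Suc u) b \<inter> near_approximants t \<noteq> {}}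
      \<le> 16 * Suc (floor_log t) * card (survivors G t)"
proof -
  obtain i where i: "gap t = Suc i" using gap_pos[of t] by (cases "gap t") auto
  have u: "u = t + i" using assms(2) i by simp
  let ?B = "\<lambda>a. {b. b div 4 ^ gap t = a \<and> cell (t + gap t) b \<inter> near_approximants t \<noteq> {}}"
  let ?L = "{b. b div 4 \<in> survivors G u \<and> cell (Suc u) b \<inter> near_approximants t \<noteq> {}}"
  have sub: "?L \<subseteq> (\<Union>a\<in>survivors G t. ?B a)"
  proof
    fix b assume b: "b \<in> ?L"
    then have "b div 4 div 4 ^ i \<in> survivors G t" using survivors_ancestor[of "b div 4" G t i] u by simp
    then have "b div 4 ^ gap t \<in> survivors G t" unfolding i by (simp add: div_mult2_eq)
    then show "b \<in> (\<Union>a\<in>survivors G t. ?B a)" using b assms(2) by auto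
  qed
  have fin: "finite (\<Union>a\<in>survivors G t. ?B a)"
    using finite_survivors card_cells_near_approximants(1)[OF assms(1)] by auto
  show "finite ?L" using finite_subset[OF sub fin] .
  have "card ?L \<le> card (\<Union>a\<in>survivors G t. ?B a)" by (rule card_mono[OF fin sub])
  also have "\<dots> \<le> (\<Sum>a\<in>survivors G t. card (?B a))" by (rule card_UN_le[OF finite_survivors])
  also have "\<dots> \<le> of_nat (card (survivors G t)) * (16 * Suc (floor_log t))"
    by (rule sum_bounded_above) (rule card_cells_near_approximants(2)[OF assms(1)])
  finally show "card ?L \<le> 16 * Suc (floor_log t) * card (survivors G t)" by (simp add: mult.commute)
qed

section \<open>Growth of the number of survivors\<close>

text \<open>Writing \<open>4 - 2 / g\<close> as \<open>4 * (1 - 1 / (2 * g))\<close>, Bernoulli's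
  inequality shows that the accumulated loss over \<open>g - 1\<close> levels is at most a factor
  2.\<close>

lemma growth_power_bound:
  fixes g :: nat assumes "g > 0"
  shows "4 ^ g / 8 \<le> (4 - 2 / real g) ^ (g - 1)"
proof -
  obtain i where g: "g = Suc i" using assms by (cases g) auto
  have "1 / 2 \<le> 1 + real i * (- (1 / (2 * real g)))"
    unfolding g by (simp add: field_simps)
  also have "\<dots> \<le> (1 + - (1 / (2 * real g))) ^ i"
    by (rule Bernoulli_inequality) (simp add: g field_simps)
  finally have "4 ^ i * (1 / 2) \<le> 4 ^ i * (1 - 1 / (2 * real g)) ^ i" by simp
  also have "\<dots> = (4 * (1 - 1 / (2 * real g))) ^ i" by (rule power_mult_distrib[symmetric])
  also have "4 * (1 - 1 / (2 * real g)) = 4 - 2 / real g" by (simp add: field_simps)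
  finally show ?thesis unfolding g by simp
qed

text \<open>Each set is removed at the level whose cell length equals the radius of its balls, so
  that every ball costs at most four cells.\<close>

definition forbidden :: "nat \<Rightarrow> (nat \<Rightarrow> real set) \<Rightarrow> (nat \<Rightarrow> nat) \<Rightarrow> nat \<Rightarrow> real set" where
  "forbidden t0 U l t =
     (\<Union>s\<in>{s. t0 \<le> s \<and> s + gap s = t}. near_approximants s) \<union> (\<Union>i\<in>{i. l i = t}. U i)"

text \<open>A strong induction shows that the branching factor at level \<open>t\<close> is at least
  \<open>4 - 2 / gap t\<close>. By \<open>gap_s\<close> this dominates \<open>4 powr s\<close> from
  \<open>t0\<close> on, so \<open>few\<close> says that the cells lost to the \<open>U i\<close> are
  at most a fraction \<open>1 / gap t\<close> of the survivors.\<close>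

lemma survivors_growth:
  fixes U :: "nat \<Rightarrow> real set" and s :: real
  assumes t0: "t0 \<ge> 20" and s: "s \<le> 1"
    and gap_s: "\<And>t. t \<ge> t0 \<Longrightarrow> 4 powr s \<le> 4 - 2 / real (gap t)"
    and U: "\<And>i. U i \<subseteq> cball (c i) (1 / 4 ^ l i)"
    and l: "\<And>i. t0 < l i" "\<And>t. finite {i. l i = t}"
    and few: "\<And>t. t \<ge> t0 \<Longrightarrow> 4 * real (card {i. l i = Suc t}) * real (gap t) \<le> 4 powr (s * real t)"
  shows "survivors (forbidden t0 U l) t \<noteq> {}"
proof -
  define G where "G = forbidden t0 U l"
  define N where "N t = real (card (survivors G t))" for t
  \<comment> \<open>Nothing is removed up to level \<open>t0\<close>: a scale from \<open>t0\<close>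
    on becomes due only later, because gaps are positive, and every \<open>l i\<close> exceeds
    \<open>t0\<close>.\<close>
  have early: "4 * N t \<le> N (Suc t)" if "t < t0" for t
  proof -
    have "s + gap s \<noteq> Suc t" if "t0 \<le> s" for s
      using that \<open>t < t0\<close> gap_pos[of s] by linarith
    moreover have "l i \<noteq> Suc t" for i using l(1)[of i] that by linarith
    ultimately have "G (Suc t) = {}" unfolding G_def forbidden_def by auto
    then show ?thesis using card_survivors_Suc[of G t] unfolding N_def by simp
  qed
  \<comment> \<open>Stated under the growth hypothesis below \<open>u\<close>, because the induction
    that proves growth at \<open>t\<close> already uses this bound for \<open>N t\<close>.\<close>
  have N_lower: "4 powr (s * real u) \<le> N u" if "\<And>v. v < u \<Longrightarrow> (4 - 2 / real (gap v)) * N v \<le> N (Suc v)" for u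
    using that
  proof (induction u)
    case 0
    then show ?case by (simp add: N_def)
  next
    case (Suc u)
    have IH: "4 powr (s * real u) \<le> N u" using Suc by simp
    then have "N u \<ge> 0" unfolding N_def by simp
    have "4 powr (s * real (Suc u)) = 4 powr s * 4 powr (s * real u)"
      by (simp add: powr_add[symmetric] algebra_simps)
    also have "\<dots> \<le> 4 powr s * N u" using IH by simp
    also have "\<dots> \<le> N (Suc u)"
    proof (cases "u < t0")
      case True
      have "4 powr s \<le> 4 powr (1::real)" using s by (intro powr_mono) auto
      then have "4 powr s * N u \<le> 4 * N u" using \<open>N u \<ge> 0\<close> by (intro mult_right_mono) auto
      then show ?thesis using early[OF True] by linarith
    next
      case False
      then have "4 powr s * N u \<le> (4 - 2 / real (gap u)) * N u"
        using gap_s[of u] \<open>N u \<ge> 0\<close> by (intro mult_right_mono) auto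
      then show ?thesis using Suc.prems[of u] by simp
    qed
    finally show ?case .
  qed
  \<comment> \<open>One unit \<open>N t / gap t\<close> of the loss pays for the neighbourhoods, the other for the \<open>U i\<close>.\<close>
  have growth: "(4 - 2 / real (gap t)) * N t \<le> N (Suc t)" for t
  proof (induction t rule: less_induct)
    case (less t)
    have N0: "N u \<ge> 0" for u unfolding N_def by simp
    have g0: "real (gap u) > 0" for u using gap_pos[of u] by simp
    show ?case
    proof (cases "t < t0")
      case True
      have "(4 - 2 / real (gap t)) * N t \<le> 4 * N t" using N0 by (intro mult_right_mono) auto
      then show ?thesis using early[OF True] by linarith
    next
      case False
      then have t: "t \<ge> t0" by simp
      let ?S = "{s. t0 \<le> s \<and> s + gap s = Suc t}" and ?I = "{i. l i = Suc t}"
      let ?V = "{b. b div 4 \<in> survivors G t \<and> cell (Suc t) b \<inter> (\<Union>s\<in>?S. near_approximants s) \<noteq> {}}"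
      let ?W = "\<Union>i\<in>?I. {b. cell (Suc t) b \<inter> U i \<noteq> {}}"
      have W1: "finite {b. cell (Suc t) b \<inter> U i \<noteq> {}}" "card {b. cell (Suc t) b \<inter> U i \<noteq> {}} \<le> 4" if "i \<in> ?I" for i
        using card_cells_meeting[of "U i" "c i" "Suc t"] U[of i] that by auto
      have W_fin: "finite ?W" using l(2)[of "Suc t"] W1(1) by auto
      have "card ?W \<le> (\<Sum>i\<in>?I. card {b. cell (Suc t) b \<inter> U i \<noteq> {}})" by (rule card_UN_le[OF l(2)])
      also have "\<dots> \<le> of_nat (card ?I) * 4" by (rule sum_bounded_above) (rule W1)
      finally have "real (card ?W) \<le> 4 * real (card ?I)" by simp
      then have "real (card ?W) * real (gap t) \<le> 4 * real (card ?I) * real (gap t)"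
        using g0[of t] by (intro mult_right_mono) auto
      also have "\<dots> \<le> 4 powr (s * real t)" using few[OF t] .
      also have "\<dots> \<le> N t" using N_lower[OF less.IH] .
      finally have W: "real (card ?W) \<le> N t / real (gap t)" using g0[of t] by (simp add: field_simps)
      have V: "finite ?V \<and> real (card ?V) \<le> N t / real (gap t)"
      proof (cases "?S = {}")
        case True
        have "?V = {}" unfolding True by simp
        then show ?thesis using N0[of t] g0[of t] by (simp only: card.empty) simp
      next
        case False
        then obtain r where r: "t0 \<le> r" "r + gap r = Suc t" by blast
        \<comment> \<open>As \<open>gap\<close> is monotone, \<open>s + gap s\<close> is strictly
          increasing in \<open>s\<close>, so at most one scale becomes due at each level.\<close>
        have uniq: "?S = {r}"
        proof (intro equalityI subsetI)
          fix r' assume "r' \<in> ?S"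
          then have r': "r' + gap r' = r + gap r" using r by simp
          have "gap x \<le> gap y" if "x \<le> y" for x y by (rule monoD[OF gap_mono that])
          from this[of r r'] this[of r' r] r' show "r' \<in> {r}" by (cases "r \<le> r'") auto
        qed (use r in auto)
        have "r \<ge> 20" using r t0 by simp
        define g where "g = gap r"
        have g: "g > 0" unfolding g_def by (rule gap_pos)
        have "gap r \<le> r" using gap_le_self \<open>r \<ge> 20\<close> by simp
        \<comment> \<open>Since \<open>gap r \<le> r\<close>, the level
          \<open>t = r + gap r - 1\<close> is below \<open>2 * r\<close>.\<close>
        then have "gap t \<le> 2 * g" unfolding g_def
          using r \<open>r \<ge> 20\<close> gap_pos[of r] by (intro gap_doubling) auto
        \<comment> \<open>The induction hypothesis is iterated from level \<open>r\<close> up to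
          \<open>t = r + g - 1\<close>. Since \<open>gap\<close> is monotone, each factor on the way
          is at least \<open>4 - 2 / g\<close>.\<close>
        have step: "(4 - 2 / real g) ^ i * N r \<le> N (r + i)" if "i \<le> g - 1" for i
          using that
        proof (induction i)
          case (Suc i)
          have "r + i < t" using Suc.prems r g unfolding g_def by linarith
          have "gap r \<le> gap (r + i)" by (rule monoD[OF gap_mono]) simp
          then have "2 / real (gap (r + i)) \<le> 2 / real g"
            unfolding g_def using gap_pos[of r] by (intro divide_left_mono) auto
          moreover have "2 / real g \<le> 2" using g by (simp add: field_simps)
          ultimately have "(4 - 2 / real g) * ((4 - 2 / real g) ^ i * N r) \<le> (4 - 2 / real (gap (r + i))) * N (r + i)"
            using Suc N0 by (intro mult_mono) auto
          also have "\<dots> \<le> N (Suc (r + i))" using less.IH[OF \<open>r + i < t\<close>] .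
          finally show ?case by (simp add: mult.assoc)
        qed simp
        have "r + (g - 1) = t" using r g unfolding g_def by linarith
        then have "(4 - 2 / real g) ^ (g - 1) * N r \<le> N t" using step[of "g - 1"] by simp
        moreover have "4 ^ g / 8 * N r \<le> (4 - 2 / real g) ^ (g - 1) * N r"
          using growth_power_bound[OF g] N0 by (intro mult_right_mono) auto
        ultimately have big: "4 ^ g / 8 * N r \<le> N t" by linarith
        have "?V = {b. b div 4 \<in> survivors G t \<and> cell (Suc t) b \<inter> near_approximants r \<noteq> {}}"
          unfolding uniq by simp
        then have V: "finite ?V" "card ?V \<le> 16 * Suc (floor_log r) * card (survivors G r)"
          using card_survivors_near_approximants[of r t G] r(2) \<open>r \<ge> 20\<close> by auto
        \<comment> \<open>The constant 256 in \<open>gap\<close> is \<open>8 * 16 * 2\<close>: the 8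
          of \<open>growth_power_bound\<close>, the 16 cells for each \<open>n\<close>, and the 2 of
          \<open>gap t \<le> 2 * g\<close>.\<close>
        have "card ?V * gap t \<le> 16 * Suc (floor_log r) * card (survivors G r) * (2 * g)"
          using V(2) \<open>gap t \<le> 2 * g\<close> by (rule mult_mono) auto
        then have "8 * (card ?V * gap t) \<le> 256 * Suc (floor_log r) * g * card (survivors G r)"
          by (simp add: algebra_simps)
        also have "\<dots> \<le> 4 ^ g * card (survivors G r)"
          unfolding g_def by (rule mult_right_mono[OF gap_lower]) simp
        finally have "real (8 * (card ?V * gap t)) \<le> real (4 ^ g * card (survivors G r))" by (rule of_nat_mono)
        then have "real (card ?V) * real (gap t) \<le> 4 ^ g / 8 * N r" unfolding N_def by simp
        then have "real (card ?V) * real (gap t) \<le> N t" using big by linarith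
        then show ?thesis using V(1) g0[of t] by (simp add: field_simps)
      qed
      have "{b. b div 4 \<in> survivors G t \<and> cell (Suc t) b \<inter> G (Suc t) \<noteq> {}} \<subseteq> ?V \<union> ?W"
        unfolding G_def forbidden_def by blast
      then have "card {b. b div 4 \<in> survivors G t \<and> cell (Suc t) b \<inter> G (Suc t) \<noteq> {}} \<le> card (?V \<union> ?W)"
        using V W_fin by (intro card_mono) auto
      also have "\<dots> \<le> card ?V + card ?W" by (rule card_Un_le)
      finally have "4 * card (survivors G t) \<le> card (survivors G (Suc t)) + (card ?V + card ?W)"
        using card_survivors_Suc[of G t] by linarith
      then have "real (4 * card (survivors G t)) \<le> real (card (survivors G (Suc t)) + (card ?V + card ?W))"
        by (rule of_nat_mono)
      then have "4 * N t \<le> N (Suc t) + (real (card ?V) + real (card ?W))" unfolding N_def by simp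
      then have "4 * N t - 2 * (N t / real (gap t)) \<le> N (Suc t)" using V W by linarith
      then show ?thesis by (simp add: left_diff_distrib)
    qed
  qed
  have "0 < 4 powr (s * real t)" by simp
  also have "\<dots> \<le> N t" using N_lower growth by blast
  finally show ?thesis unfolding N_def G_def by auto
qed

section \<open>Points avoiding all neighbourhoods\<close>

lemma partial_prod_eq:
  assumes "\<And>n. n \<ge> 1 \<Longrightarrow> d n = 2 ^ (2 ^ n)"
  shows "partial_prod d n = 4 ^ (2 ^ n - 1)"
proof (induction n)
  case (Suc n)
  have "partial_prod d (Suc n) = 4 ^ (2 ^ n - 1) * d (Suc n)"
    using Suc unfolding partial_prod_def by simp
  also have "d (Suc n) = (2 ^ 2) ^ (2 ^ n)" using assms[of "Suc n"] by (simp only: flip: power_mult) simp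
  also have "4 ^ (2 ^ n - 1) * (2 ^ 2) ^ (2 ^ n) = (4::nat) ^ (2 ^ n - 1 + 2 ^ n)"
    by (simp only: power_add) simp
  also have "2 ^ n - 1 + 2 ^ n = (2::nat) ^ Suc n - 1" using one_le_power[of "2::nat" n] by simp
  finally show ?case .
qed (simp add: partial_prod_def)

text \<open>For \<open>q > 0\<close> only finitely many partial products divide \<open>q\<close>, so
  the infimum is a minimum.\<close>

lemma pseudo_abs_attained:
  assumes d: "\<And>n. n \<ge> 1 \<Longrightarrow> d n = 2 ^ (2 ^ n)" and "q > 0"
  obtains n where "4 ^ (2 ^ n - 1) dvd q" "pseudo_abs d (int q) = 1 / 4 ^ (2 ^ n - 1)"
proof -
  define A where "A = {n. int (partial_prod d n) dvd int q}"
  have A: "A = {n. 4 ^ (2 ^ n - 1) dvd q}"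
    unfolding A_def by (simp only: int_dvd_int_iff partial_prod_eq[OF d])
  have "A \<subseteq> {..q}"
  proof
    fix n assume "n \<in> A"
    then have "4 ^ (2 ^ n - 1) \<le> q" unfolding A using \<open>q > 0\<close> by (auto dest: dvd_imp_le)
    moreover have "2 ^ n - 1 < (4::nat) ^ (2 ^ n - 1)"
      by (rule less_le_trans[OF less_exp]) (simp add: power_mono)
    moreover have "n \<le> 2 ^ n - 1" using less_exp[of n] by linarith
    ultimately have "n \<le> q" by linarith
    then show "n \<in> {..q}" by simp
  qed
  then have "finite A" by (rule finite_subset) simp
  moreover have "0 \<in> A" unfolding A by simp
  ultimately have fin: "finite ((\<lambda>n. inverse (real (partial_prod d n))) ` A)"
    "(\<lambda>n. inverse (real (partial_prod d n))) ` A \<noteq> {}" by auto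
  have "pseudo_abs d (int q) = Inf ((\<lambda>n. inverse (real (partial_prod d n))) ` A)"
    unfolding pseudo_abs_def A_def by (simp only: setcompr_eq_image)
  also have "\<dots> = Min ((\<lambda>n. inverse (real (partial_prod d n))) ` A)"
    by (rule cInf_eq_Min[OF fin])
  also have "\<dots> \<in> (\<lambda>n. inverse (real (partial_prod d n))) ` A" by (rule Min_in[OF fin])
  finally obtain n where n: "n \<in> A" "pseudo_abs d (int q) = inverse (real (partial_prod d n))" by blast
  show thesis
  proof (rule that)
    show "4 ^ (2 ^ n - 1) dvd q" using n(1) unfolding A by simp
    show "pseudo_abs d (int q) = 1 / 4 ^ (2 ^ n - 1)"
      unfolding n(2) using partial_prod_eq[OF d] by (simp add: inverse_eq_divide)
  qed
qed

text \<open>The argument \<open>(t - 1) / 2\<close> will be a lower bound for \<open>ln q\<close>.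
  The bounds on \<open>gap t\<close> give about \<open>4096 * ln t * ln (ln t)\<close>, and 10000
  leaves room for the lower-order terms.\<close>

lemma gap_iterated_log:
  "eventually (\<lambda>t. 4 ^ gap t \<le> 10000 * (ln ((real t - 1) / 2) * ln (ln ((real t - 1) / 2)))) sequentially"
proof -
  have log2: "log 2 x \<le> 2 * ln x" if "1 \<le> x" for x :: real
  proof -
    have "ln x * 1 \<le> ln x * (2 * ln 2)" using that ln2_ge_two_thirds by (intro mult_left_mono) auto
    then show ?thesis unfolding log_def by (simp add: field_simps)
  qed
  have "eventually (\<lambda>t::nat. 1024 * (1 + 2 * ln t) * (2 * ln (1024 * (1 + 2 * ln t)))
      \<le> 10000 * (ln ((real t - 1) / 2) * ln (ln ((real t - 1) / 2)))) sequentially"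
    by real_asymp
  with eventually_gt_at_top[of 0] show ?thesis
  proof eventually_elim
    case (elim t)
    define k where "k = Suc (floor_log t)"
    have "2 ^ floor_log t \<le> t" using elim(1) by (simp add: floor_log_exp2_le)
    then have "real (2 ^ floor_log t) \<le> real t" by (rule of_nat_mono)
    then have "real (floor_log t) \<le> log 2 t" using elim(1) by (simp add: le_log_iff powr_realpow)
    then have k: "real k \<le> 1 + 2 * ln t" unfolding k_def using log2[of t] elim(1) by simp
    have "real (2 ^ gap t) \<le> real (1024 * k)"
      using two_pow_gap_upper[of t] unfolding k_def by (intro of_nat_mono) simp
    then have "real (gap t) \<le> log 2 (1024 * k)" unfolding k_def by (simp add: le_log_iff powr_realpow)
    also have "\<dots> \<le> 2 * ln (1024 * k)" unfolding k_def by (rule log2) simp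
    also have "\<dots> \<le> 2 * ln (1024 * (1 + 2 * ln t))"
      using k unfolding k_def by simp
    finally have g: "real (gap t) \<le> 2 * ln (1024 * (1 + 2 * ln t))" .
    have "real (4 ^ gap t) \<le> real (1024 * k * gap t)"
      using gap_upper[of t] unfolding k_def by (intro of_nat_mono) simp
    also have "\<dots> = 1024 * real k * real (gap t)" by simp
    also have "\<dots> \<le> 1024 * (1 + 2 * ln t) * (2 * ln (1024 * (1 + 2 * ln t)))"
      using k g elim(1) by (intro mult_mono) auto
    finally show ?case using elim(2) by simp
  qed
qed

lemma liminf_pos_of_avoids:
  assumes d: "\<And>n. n \<ge> 1 \<Longrightarrow> d n = 2 ^ (2 ^ n)"
    and \<alpha>: "\<And>t. t \<ge> t0 \<Longrightarrow> \<alpha> \<notin> near_approximants t"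
  shows "liminf (\<lambda>q::nat. ereal (real q * ln (ln (real q)) * ln (ln (ln (real q)))
        * pseudo_abs d (int q) * dist_nearest_int (real q * \<alpha>))) > 0"
proof -
  define lx where "lx t = (real t - 1) / 2" for t :: nat
  have "eventually (\<lambda>t. ln (ln (lx t)) > 0) sequentially" unfolding lx_def by real_asymp
  moreover have "eventually (\<lambda>t. ln (lx t) > 0) sequentially" unfolding lx_def by real_asymp
  moreover have "eventually (\<lambda>t. lx t > 0) sequentially" unfolding lx_def by real_asymp
  moreover have "eventually (\<lambda>t. 4 ^ gap t \<le> 10000 * (ln (lx t) * ln (ln (lx t)))) sequentially"
    using gap_iterated_log unfolding lx_def .
  ultimately have "eventually (\<lambda>t. lx t > 0 \<and> ln (lx t) > 0 \<and> ln (ln (lx t)) > 0 \<and>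
      4 ^ gap t \<le> 10000 * (ln (lx t) * ln (ln (lx t)))) sequentially"
    by eventually_elim simp
  then obtain T where T: "\<And>t. t \<ge> T \<Longrightarrow> lx t > 0 \<and> ln (lx t) > 0 \<and> ln (ln (lx t)) > 0 \<and>
      4 ^ gap t \<le> 10000 * (ln (lx t) * ln (ln (lx t)))"
    unfolding eventually_sequentially by blast
  \<comment> \<open>The constant is \<open>1 / (4 * 10000)\<close>: 10000 comes from
    \<open>gap_iterated_log\<close>, and 4 from
    \<open>4 ^ t \<le> 4 * D * r\<^sup>2\<close>.\<close>
  have main: "1 / 40000 \<le> real q * ln (ln (real q)) * ln (ln (ln (real q)))
        * pseudo_abs d (int q) * dist_nearest_int (real q * \<alpha>)" if q: "q \<ge> 4 ^ (T + t0)" for q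
  proof -
    have "q > 0" using q by (rule less_le_trans[rotated]) simp
    then obtain n where n: "4 ^ (2 ^ n - 1) dvd q" "pseudo_abs d (int q) = 1 / 4 ^ (2 ^ n - 1)"
      using pseudo_abs_attained[OF d] by blast
    define D :: nat where "D = 4 ^ (2 ^ n - 1)"
    have D: "D > 0" unfolding D_def by simp
    obtain r where r: "q = D * r" using n(1) unfolding D_def by blast
    have "r > 0" using r \<open>q > 0\<close> by auto
    \<comment> \<open>The factorisation \<open>q = D * r\<close> and the dyadic size of
      \<open>r\<close> assign to \<open>q\<close> the scale \<open>t = 2 ^ n + j\<close>, at which
      \<open>p / q\<close> is an approximant for every integer \<open>p\<close>.\<close>
    define j where "j = floor_log r"
    have j: "2 ^ j \<le> r" "r < 2 ^ Suc j"
      unfolding j_def using floor_log_exp2_le[OF \<open>r > 0\<close>] floor_log_exp2_gt[of r] by auto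
    define t where "t = 2 ^ n + j"
    have one: "(1::nat) \<le> 2 ^ n" by simp
    have "(2::nat) ^ Suc j \<le> 4 ^ Suc j" by (rule power_mono) auto
    then have "q < D * 4 ^ Suc j" unfolding r using j D by simp
    also have "\<dots> = 4 ^ t" unfolding D_def t_def power_add[symmetric] using one by simp
    finally have "q < 4 ^ t" .
    with q have "(4::nat) ^ (T + t0) < 4 ^ t" by (rule le_less_trans)
    then have "T + t0 < t" by (rule power_less_imp_less_exp[rotated]) simp
    then have t: "T \<le> t" "t0 \<le> t" by auto
    \<comment> \<open>While \<open>q < 4 ^ t\<close> made \<open>t\<close> large, this opposite
      bound makes \<open>ln q\<close> at least \<open>(t - 1) * ln 2\<close>, hence at least
      \<open>lx t\<close>.\<close>
    have "(2::nat) ^ (t - 1) \<le> 2 ^ (2 * (2 ^ n - 1) + j)"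
      unfolding t_def using one by (intro power_increasing) auto
    also have "\<dots> = D * 2 ^ j" unfolding D_def power_add power_mult by simp
    also have "\<dots> \<le> q" unfolding r using j by simp
    finally have "real (2 ^ (t - 1)) \<le> real q" by (rule of_nat_mono)
    then have "ln (2 ^ (t - 1)) \<le> ln (real q)" using \<open>q > 0\<close> by simp
    moreover have "1 \<le> t" unfolding t_def using one by linarith
    then have "real (t - 1) = real t - 1" by simp
    moreover note \<open>real (t - 1) = real t - 1\<close>
    moreover have "(real t - 1) / 2 \<le> (real t - 1) * ln 2"
      using ln2_ge_two_thirds \<open>real (t - 1) = real t - 1\<close> mult_left_mono[of "1 / 2" "ln 2" "real t - 1"] by simp
    ultimately have lq: "lx t \<le> ln (real q)" unfolding lx_def by (simp add: ln_realpow)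
    note Tt = T[OF t(1)]
    have llq: "ln (lx t) \<le> ln (ln (real q))" using lq Tt by simp
    have lllq: "ln (ln (lx t)) \<le> ln (ln (ln (real q)))" using llq Tt by simp
    have "ln (lx t) * ln (ln (lx t)) \<le> ln (ln (real q)) * ln (ln (ln (real q)))"
      using llq lllq Tt by (intro mult_mono) auto
    then have \<phi>: "4 ^ gap t / 10000 \<le> ln (ln (real q)) * ln (ln (ln (real q)))" using Tt by linarith
    define p where "p = round (real q * \<alpha>)"
    define x where "x = of_int p / (real D * real r)"
    have "x \<in> approximants n (t - 2 ^ n)"
      unfolding approximants_def x_def D_def t_def using j by auto
    moreover have "2 ^ n \<le> t" unfolding t_def by simp
    ultimately have "\<alpha> \<notin> cball x (1 / 4 ^ (t + gap t))"
      using \<alpha>[OF t(2)] unfolding near_approximants_def by blast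
    then have far: "1 / 4 ^ (t + gap t) \<le> \<bar>x - \<alpha>\<bar>" by (simp add: dist_real_def)
    have "real q * \<alpha> - of_int p = - (real q * (x - \<alpha>))"
      unfolding x_def r using D \<open>r > 0\<close> by (simp add: field_simps)
    then have "dist_nearest_int (real q * \<alpha>) = real q * \<bar>x - \<alpha>\<bar>"
      unfolding dist_nearest_int_def p_def[symmetric] by (simp add: abs_mult)
    then have near: "real q * (1 / 4 ^ (t + gap t)) \<le> dist_nearest_int (real q * \<alpha>)"
      using far by (simp only: mult_left_mono of_nat_0_le_iff)
    \<comment> \<open>Since \<open>q * pseudo_abs d q = r\<close>, the quantity without the
      logarithms is at least \<open>r * q / 4 ^ (t + gap t)\<close>, where
      \<open>r * q = D * r\<^sup>2\<close> is at least \<open>4 ^ t / 4\<close>. The remaining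
      \<open>4 ^ gap t\<close> is paid for by the logarithms.\<close>
    have "2 ^ j * 2 ^ j \<le> r * r" using j by (intro mult_mono) auto
    then have "(4::nat) ^ j \<le> r * r" by (simp flip: power_mult_distrib)
    then have "4 * D * 4 ^ j \<le> 4 * D * (r * r)" by simp
    moreover have "4 ^ t = 4 * D * 4 ^ j"
      unfolding D_def t_def using one by (simp add: power_add power_minus_mult flip: power_Suc)
    ultimately have "real (4 ^ t) \<le> real (4 * D * (r * r))" by (intro of_nat_mono) simp
    then have rr: "4 ^ t \<le> 4 * real D * (real r * real r)" by simp
    have "(1 :: real) / 40000 = (4 ^ t / 4 * (1 / 4 ^ (t + gap t))) * (4 ^ gap t / 10000)"
      by (simp add: power_add)
    also have "\<dots> \<le> (real D * (real r * real r) * (1 / 4 ^ (t + gap t))) * (4 ^ gap t / 10000)"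
      using rr by (intro mult_right_mono) auto
    also have "\<dots> = (real r * (real q * (1 / 4 ^ (t + gap t)))) * (4 ^ gap t / 10000)"
      unfolding r by simp
    also have "\<dots> \<le> (real r * dist_nearest_int (real q * \<alpha>)) * (ln (ln (real q)) * ln (ln (ln (real q))))"
      using near \<phi> by (intro mult_mono) (auto simp: dist_nearest_int_def)
    also have "real r = real q * pseudo_abs d (int q)"
      unfolding n(2) using D by (simp add: r D_def)
    finally show ?thesis by (simp only: ac_simps)
  qed
  have "(0::ereal) < ereal (1 / 40000)" by simp
  also have "\<dots> \<le> liminf (\<lambda>q::nat. ereal (real q * ln (ln (real q)) * ln (ln (ln (real q)))
        * pseudo_abs d (int q) * dist_nearest_int (real q * \<alpha>)))"
    by (intro Liminf_bounded eventually_sequentiallyI[of "4 ^ (T + t0)"]) (simp only: main ereal_less_eq)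
  finally show ?thesis .
qed

section \<open>Hausdorff measures on the real line\<close>

lemma hausdorff_cost_eq:
  assumes "s > 0" shows "hausdorff_cost s U = ennreal (diameter U powr s)"
  using assms by (auto simp: hausdorff_cost_def diameter_def)

lemma hausdorff_cost_antimono:
  assumes "0 \<le> s" "s \<le> s'" "0 < s'" "bounded U" "diameter U \<le> 1"
  shows "hausdorff_cost s' U \<le> hausdorff_cost s U"
proof -
  have d: "0 \<le> diameter U" using assms(4) by (rule diameter_ge_0)
  show ?thesis
  proof (cases "s = 0")
    case True
    have "diameter U powr s' \<le> 1" using d assms by (intro powr_le1) auto
    then show ?thesis using True assms(3) by (simp add: hausdorff_cost_def)
  next
    case False
    then have "s > 0" using assms(1) by simp
    have "diameter U powr s' \<le> diameter U powr s"
    proof (cases "diameter U = 0")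
      case False
      then show ?thesis using d assms by (intro powr_mono') auto
    qed simp
    then show ?thesis using \<open>s > 0\<close> assms(3) by (simp add: hausdorff_cost_eq ennreal_leI)
  qed
qed

text \<open>Covering sets of diameter at most 1 get cheaper as the exponent grows. The case
  \<open>s = 0\<close> is included, so that later arguments can move to a positive exponent.\<close>

lemma hausdorff_premeasure_antimono:
  assumes "0 \<le> s" "s \<le> s'" "0 < s'"
  shows "hausdorff_premeasure s' 1 S \<le> hausdorff_premeasure s 1 S"
  unfolding hausdorff_premeasure_def
proof (rule INF_mono)
  fix U assume U: "U \<in> hausdorff_covers 1 S"
  have "(\<Sum>i. hausdorff_cost s' (U i)) \<le> (\<Sum>i. hausdorff_cost s (U i))"
    using U assms by (intro suminf_le hausdorff_cost_antimono) (auto simp: hausdorff_covers_def)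
  then show "\<exists>V\<in>hausdorff_covers 1 S. (\<Sum>i. hausdorff_cost s' (V i)) \<le> (\<Sum>i. hausdorff_cost s (U i))"
    using U by blast
qed

section \<open>Covers of null sets, sorted by 4-adic scale\<close>

lemma four_adic_scale:
  fixes e :: real
  assumes "0 < e" "e \<le> 1"
  obtains l where "e \<le> 1 / 4 ^ l" "1 / 4 ^ l \<le> 4 * e"
proof -
  have ex: "\<exists>m. (1 / 4) ^ m < e" using assms by (intro real_arch_pow_inv) auto
  define m where "m = (LEAST m. (1 / 4) ^ m < e)"
  have m: "(1 / 4) ^ m < e" unfolding m_def by (rule LeastI_ex[OF ex])
  then have "m \<noteq> 0" using assms by (cases m) auto
  then obtain l where l: "m = Suc l" by (cases m) auto
  have "\<not> (1 / 4) ^ l < e" by (rule not_less_Least) (use l in \<open>simp add: m_def[symmetric]\<close>)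
  then have "e \<le> 1 / 4 ^ l" by (simp add: power_divide)
  moreover have "1 / 4 ^ l \<le> 4 * e" using m unfolding l by (simp add: power_divide)
  ultimately show thesis using that by blast
qed

text \<open>Every index of scale \<open>t\<close> contributes at least
  \<open>4 powr (- (s * t)) / 4\<close> to a slightly padded total cost. A small total therefore
  bounds the number of indices at each scale.\<close>

lemma null_set_scaled_cover:
  fixes S :: "real set"
  assumes s: "0 < s" "s \<le> 1" and null: "hausdorff_premeasure s 1 S = 0" and \<epsilon>: "\<epsilon> > 0"
  obtains U :: "nat \<Rightarrow> real set" and c l where "S \<subseteq> (\<Union>i. U i)" "\<And>i. U i \<subseteq> cball (c i) (1 / 4 ^ l i)"
    "\<And>t. finite {i. l i = t}" "\<And>t. real (card {i. l i = t}) \<le> \<epsilon> * 4 powr (s * real t)"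
proof -
  \<comment> \<open>The padded costs sum to at most \<open>2 * \<eta>\<close>. This must be at most
    1 for a scale to exist, and \<open>4 * (2 * \<eta>)\<close> must be at most
    \<open>\<epsilon>\<close> in the count.\<close>
  define \<eta> where "\<eta> = min (\<epsilon> / 8) (1 / 2)"
  have \<eta>: "0 < \<eta>" "2 * \<eta> \<le> 1" "8 * \<eta> \<le> \<epsilon>" using \<epsilon> unfolding \<eta>_def by auto
  have "(INF U\<in>hausdorff_covers 1 S. \<Sum>i. hausdorff_cost s (U i)) < ennreal \<eta>"
    using null \<eta>(1) unfolding hausdorff_premeasure_def by simp
  then obtain U where U: "U \<in> hausdorff_covers 1 S" "(\<Sum>i. hausdorff_cost s (U i)) < ennreal \<eta>"
    unfolding INF_less_iff by blast
  define w where "w i = diameter (U i) powr s" for i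
  \<comment> \<open>The geometric padding keeps \<open>a i\<close> positive, so that even sets of
    diameter 0 receive a scale, and adds at most \<open>\<eta>\<close> in total.\<close>
  define a where "a i = w i + \<eta> * (1 / 2) ^ Suc i" for i
  have w0: "0 \<le> w i" for i unfolding w_def by simp
  have a0: "0 < a i" for i using w0[of i] \<eta>(1) unfolding a_def by (intro add_nonneg_pos) auto
  have sum_a: "sum a I \<le> 2 * \<eta>" if "finite I" for I
  proof -
    have "ennreal (sum w I) = (\<Sum>i\<in>I. hausdorff_cost s (U i))"
      using w0 s(1) by (simp add: hausdorff_cost_eq w_def)
    also have "\<dots> \<le> (\<Sum>i. hausdorff_cost s (U i))" using that by (intro sum_le_suminf) auto
    also have "\<dots> < ennreal \<eta>" by (rule U(2))
    finally have "sum w I \<le> \<eta>" using \<eta>(1) by (simp add: ennreal_less_iff sum_nonneg w0)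
    moreover have "(\<Sum>i\<in>I. (1 / 2 :: real) ^ Suc i) \<le> (\<Sum>i. (1 / 2) ^ Suc i)"
      using that power_half_series by (intro sum_le_suminf) (auto simp: sums_iff)
    then have "\<eta> * (\<Sum>i\<in>I. (1 / 2) ^ Suc i) \<le> \<eta> * 1"
      using \<eta>(1) power_half_series by (intro mult_left_mono) (auto simp: sums_iff)
    then have "(\<Sum>i\<in>I. \<eta> * (1 / 2) ^ Suc i) \<le> \<eta>"
      by (simp only: sum_distrib_left mult_1_right)
    ultimately show ?thesis unfolding a_def sum.distrib by linarith
  qed
  have "\<exists>l. a i powr (1 / s) \<le> 1 / 4 ^ l \<and> 1 / 4 ^ l \<le> 4 * a i powr (1 / s)" for i
  proof -
    have "a i \<le> 1" using sum_a[of "{i}"] \<eta>(2) by simp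
    then have "a i powr (1 / s) \<le> 1" using a0[of i] s by (intro powr_le1) auto
    moreover have "0 < a i powr (1 / s)" using a0[of i] by simp
    ultimately show ?thesis using four_adic_scale by blast
  qed
  then obtain l where l: "\<And>i. a i powr (1 / s) \<le> 1 / 4 ^ l i" "\<And>i. 1 / 4 ^ l i \<le> 4 * a i powr (1 / s)"
    by metis
  have scale: "4 powr (- (s * real (l i))) \<le> 4 * a i" for i
  proof -
    have "4 powr (- (s * real (l i))) = (1 / 4 ^ l i) powr s"
      by (simp add: powr_minus powr_divide powr_powr mult.commute inverse_eq_divide flip: powr_realpow)
    also have "\<dots> \<le> (4 * a i powr (1 / s)) powr s" using l(2) s by (intro powr_mono2) auto
    also have "\<dots> = 4 powr s * a i" using s a0[of i] by (simp add: powr_mult powr_powr)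
    also have "\<dots> \<le> 4 powr 1 * a i" using s a0[of i] by (intro mult_right_mono powr_mono) auto
    finally show ?thesis by simp
  qed
  have bound: "real (card I) \<le> \<epsilon> * 4 powr (s * real t)" if "finite I" "I \<subseteq> {i. l i = t}" for I t
  proof -
    have "real (card I) * 4 powr (- (s * real t)) = (\<Sum>i\<in>I. 4 powr (- (s * real (l i))))"
      using that(2) by (simp add: subset_iff)
    also have "\<dots> \<le> (\<Sum>i\<in>I. 4 * a i)" by (rule sum_mono[OF scale])
    also have "\<dots> \<le> \<epsilon>" using sum_a[OF that(1)] \<eta>(3) by (simp flip: sum_distrib_left)
    finally have "real (card I) * 4 powr (- (s * real t)) * 4 powr (s * real t) \<le> \<epsilon> * 4 powr (s * real t)"
      by (rule mult_right_mono) simp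
    then show ?thesis by (simp add: mult.assoc flip: powr_add)
  qed
  \<comment> \<open>The bound holds for all finite subsets of the class, so an infinite class would
    contain a finite subset that is too large.\<close>
  have fin: "finite {i. l i = t}" for t
  proof (rule ccontr)
    assume "infinite {i. l i = t}"
    then obtain I where I: "finite I" "card I = Suc (nat \<lceil>\<epsilon> * 4 powr (s * real t)\<rceil>)" "I \<subseteq> {i. l i = t}"
      using infinite_arbitrarily_large by blast
    then show False using bound[OF I(1,3)] by linarith
  qed
  have "\<exists>c. U i \<subseteq> cball c (1 / 4 ^ l i)" for i
  proof (cases "U i = {}")
    case False
    then obtain c where c: "c \<in> U i" by blast
    have bd: "bounded (U i)" using U(1) by (simp add: hausdorff_covers_def)
    have d0: "0 \<le> diameter (U i)" using bd by (rule diameter_ge_0)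
    then have "diameter (U i) = w i powr (1 / s)" unfolding w_def using s by (simp add: powr_powr)
    also have "\<dots> \<le> a i powr (1 / s)" using s w0[of i] \<eta>(1) unfolding a_def by (intro powr_mono2) auto
    also have "\<dots> \<le> 1 / 4 ^ l i" by (rule l(1))
    finally have "diameter (U i) \<le> 1 / 4 ^ l i" .
    then have "U i \<subseteq> cball c (1 / 4 ^ l i)"
      using diameter_bounded_bound[OF bd c] by force
    then show ?thesis by blast
  qed simp
  then obtain c where "\<And>i. U i \<subseteq> cball (c i) (1 / 4 ^ l i)" by metis
  then show thesis
    using that[of U c l] U(1) fin bound[OF fin] by (auto simp: hausdorff_covers_def)
qed

section \<open>The real line has dimension at most 1\<close>

lemma real_line_covers:
  assumes s: "s > 1" and "\<delta> > 0" "\<epsilon> > 0"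
  shows "\<exists>U\<in>hausdorff_covers \<delta> (UNIV :: real set). (\<Sum>i. hausdorff_cost s (U i)) \<le> ennreal \<epsilon>"
proof -
  \<comment> \<open>The pieces have lengths \<open>1 / (N + n + 1)\<close>: their sum diverges, that of their \<open>s\<close>-th powers does not.\<close>
  define f where "f i = (2 / real (Suc i)) powr s" for i :: nat
  have f_eq: "f i = 2 powr s * (1 / real (Suc i) powr s)" for i
    unfolding f_def by (simp add: powr_divide)
  have "summable (\<lambda>i. 1 / real (Suc i) powr s)"
    using s summable_real_powr_iff[of "- s"] summable_Suc_iff[of "\<lambda>n. real n powr - s"]
    by (simp add: powr_minus inverse_eq_divide)
  then have sf: "summable f" unfolding f_eq[abs_def] by (rule summable_mult)
  obtain N1 where N1: "\<And>n. n \<ge> N1 \<Longrightarrow> norm (\<Sum>i. f (i + n)) < \<epsilon>"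
    using suminf_exist_split[OF \<open>\<epsilon> > 0\<close> sf] by auto
  obtain N2 :: nat where N2: "1 / \<delta> \<le> real N2" using real_arch_simple by blast
  \<comment> \<open>The shift serves two ends: \<open>N1\<close> makes the tail of the costs smaller
    than \<open>\<epsilon>\<close>, and \<open>N2\<close> makes every piece shorter than or equal to
    \<open>\<delta>\<close>.\<close>
  define N where "N = N1 + N2"
  define h where "h n = (\<Sum>j<n. 1 / real (Suc (N + j)))" for n
  have h_Suc: "h (Suc n) = h n + 1 / real (Suc (N + n))" for n unfolding h_def by simp
  define V where "V n = {h n..h (Suc n)}" for n
  \<comment> \<open>Even indices cover the nonnegative half-line, odd ones its mirror image.\<close>
  define U where "U i = (if even i then V (i div 2) else uminus ` V (i div 2))" for i
  have "diameter (uminus ` V n) = diameter (V n)" for n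
    unfolding V_def by (simp add: h_Suc)
  then have diam: "diameter (U i) = 1 / real (Suc (N + i div 2))" for i
    unfolding U_def by (simp add: V_def h_Suc)
  have diam_le: "diameter (U i) \<le> \<delta>" for i
  proof -
    have "0 < 1 / \<delta>" using \<open>\<delta> > 0\<close> by simp
    then have "0 < real N2" using N2 by linarith
    have "1 / real (Suc (N + i div 2)) \<le> 1 / real N2"
      using \<open>0 < real N2\<close> unfolding N_def by (intro divide_left_mono) auto
    also have "\<dots> \<le> \<delta>" using N2 \<open>\<delta> > 0\<close> \<open>0 < real N2\<close> by (simp add: field_simps)
    finally show ?thesis unfolding diam .
  qed
  have unb: "\<exists>n. y \<le> h n" for y
  proof (rule ccontr)
    assume "\<not> (\<exists>n. y \<le> h n)"
    then have "h n \<le> y" for n by (meson less_imp_le not_le)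
    then have "summable (\<lambda>j. 1 / real (Suc (N + j)))"
      unfolding h_def by (intro summableI_nonneg_bounded) auto
    then have "summable (\<lambda>j. inverse (real (j + Suc N)))" by (simp add: inverse_eq_divide add.commute)
    then have "summable (\<lambda>j. inverse (real j))" by (subst (asm) summable_iff_shift)
    then show False using not_summable_harmonic[where 'a = real] by simp
  qed
  have V_cover: "\<exists>n. y \<in> V n" if "0 \<le> y" for y
  proof (cases "y = 0")
    case True
    then have "y \<in> V 0" unfolding V_def h_Suc by (simp add: h_def)
    then show ?thesis by blast
  next
    case False
    define m where "m = (LEAST n. y \<le> h n)"
    have m: "y \<le> h m" unfolding m_def by (rule LeastI_ex[OF unb])
    have "m \<noteq> 0"
    proof
      assume "m = 0"
      then show False using m False that by (simp add: h_def)
    qed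
    then obtain n where n: "m = Suc n" by (cases m) auto
    have "\<not> y \<le> h n" by (rule not_less_Least) (use n in \<open>simp add: m_def[symmetric]\<close>)
    then have "y \<in> V n" using m unfolding n V_def by simp
    then show ?thesis by blast
  qed
  have "y \<in> (\<Union>i. U i)" for y
  proof (cases "0 \<le> y")
    case True
    then obtain n where "y \<in> V n" using V_cover by blast
    then have "y \<in> U (2 * n)" unfolding U_def by simp
    then show ?thesis by blast
  next
    case False
    then obtain n where "- y \<in> V n" using V_cover[of "- y"] by auto
    then have "y \<in> U (Suc (2 * n))" unfolding U_def by (auto intro: image_eqI[of _ _ "- y"])
    then show ?thesis by blast
  qed
  moreover have "bounded (U i)" for i unfolding U_def V_def by auto
  ultimately have cover: "U \<in> hausdorff_covers \<delta> UNIV"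
    using diam_le unfolding hausdorff_covers_def by auto
  have "hausdorff_cost s (U i) \<le> ennreal (f (i + N))" for i
  proof -
    \<comment> \<open>Every length occurs twice, so the \<open>i\<close>-th piece has the length of
      number \<open>i div 2\<close>. The numerator 2 in \<open>f\<close> compensates for
      this.\<close>
    have "i \<le> 2 * (i div 2) + 1" by simp
    then have "real i \<le> real (2 * (i div 2) + 1)" by (rule of_nat_mono)
    then have "1 / real (Suc (N + i div 2)) \<le> 2 / real (Suc (i + N))"
      by (simp add: divide_simps)
    then have "(1 / real (Suc (N + i div 2))) powr s \<le> f (i + N)"
      unfolding f_def using s by (intro powr_mono2) auto
    then show ?thesis using s by (simp add: hausdorff_cost_eq diam ennreal_leI)
  qed
  then have "(\<Sum>i. hausdorff_cost s (U i)) \<le> (\<Sum>i. ennreal (f (i + N)))"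
    by (intro suminf_le) auto
  also have "\<dots> = ennreal (\<Sum>i. f (i + N))"
    by (rule suminf_ennreal2[OF _ summable_ignore_initial_segment[OF sf]]) (simp add: f_def)
  also have "\<dots> \<le> ennreal \<epsilon>" using N1[of N] unfolding N_def by (intro ennreal_leI) auto
  finally show ?thesis using cover by blast
qed

lemma hausdorff_measure_real_eq_0:
  fixes S :: "real set"
  assumes "s > 1" shows "hausdorff_measure s S = 0"
proof -
  have "hausdorff_premeasure s \<delta> S \<le> 0" if "\<delta> > 0" for \<delta>
  proof (rule ennreal_le_epsilon)
    fix e :: real assume "0 < e"
    obtain U where U: "U \<in> hausdorff_covers \<delta> (UNIV :: real set)" "(\<Sum>i. hausdorff_cost s (U i)) \<le> ennreal e"
      using real_line_covers[OF assms \<open>\<delta> > 0\<close> \<open>0 < e\<close>] by blast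
    have "U \<in> hausdorff_covers \<delta> S" using U(1) unfolding hausdorff_covers_def by auto
    then have "hausdorff_premeasure s \<delta> S \<le> (\<Sum>i. hausdorff_cost s (U i))"
      unfolding hausdorff_premeasure_def by (rule INF_lower)
    then show "hausdorff_premeasure s \<delta> S \<le> 0 + ennreal e" using U(2) by simp
  qed
  then have "hausdorff_measure s S \<le> 0"
    unfolding hausdorff_measure_def by (intro SUP_least) auto
  then show ?thesis by simp
qed

lemma hausdorff_dimension_real_le_1: "hausdorff_dimension (S :: real set) \<le> 1"
proof (rule ennreal_le_epsilon)
  fix e :: real assume "0 < e"
  then have "hausdorff_dimension S \<le> ennreal (1 + e)"
    unfolding hausdorff_dimension_def
    by (intro Inf_lower CollectI exI[of _ "1 + e"]) (auto simp: hausdorff_measure_real_eq_0)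
  then show "hausdorff_dimension S \<le> 1 + ennreal e" using \<open>0 < e\<close> by simp
qed

section \<open>The dimension\<close>

text \<open>\<open>gap\<close> grows at most linearly, while raising the exponent from
  \<open>s\<close> to \<open>s'\<close> gains an exponential factor. This converts a count of
  covering sets at exponent \<open>s\<close> into the condition \<open>few\<close> of
  \<open>survivors_growth\<close> at exponent \<open>s'\<close>.\<close>

lemma linear_gap_absorbed:
  fixes s s' :: real assumes "s < s'"
  obtains K where "K > 0" "\<And>t. 4 * real (gap t) * 4 powr (s * real (Suc t)) \<le> K * 4 powr (s' * real t)"
proof -
  define a where "a = (s' - s) * ln 4"
  define f where "f t = 4096 * 4 powr s * ((real t + 1) * exp (- (a * real t)))" for t :: nat
  have "a > 0" using assms unfolding a_def by simp
  then have "(\<lambda>t::nat. (real t + 1) * exp (- (a * real t))) \<longlonglongrightarrow> 0" by real_asymp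
  then have "f \<longlonglongrightarrow> 4096 * 4 powr s * 0" unfolding f_def by (rule tendsto_mult_left)
  then have "Bseq f" by (intro convergent_imp_Bseq convergentI)
  then obtain K where K: "K > 0" "\<And>t. norm (f t) \<le> K" by (rule BseqE) blast
  have "4 * real (gap t) * 4 powr (s * real (Suc t)) \<le> K * 4 powr (s' * real t)" for t
  proof -
    have "4 powr (s * real (Suc t)) = 4 powr s * 4 powr (s * real t)"
      by (simp add: algebra_simps flip: powr_add)
    also have "4 powr (s * real t) = exp (- (a * real t)) * 4 powr (s' * real t)"
      unfolding powr_def a_def by (simp add: algebra_simps flip: exp_add)
    finally have split: "4 powr (s * real (Suc t)) = 4 powr s * (exp (- (a * real t)) * 4 powr (s' * real t))" .
    have "real (gap t) \<le> real (1024 * (t + 1))" by (rule of_nat_mono[OF gap_linear])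
    then have "4 * real (gap t) * 4 powr (s * real (Suc t)) \<le> 4096 * (real t + 1) * 4 powr (s * real (Suc t))"
      by (intro mult_right_mono) auto
    also have "\<dots> = f t * 4 powr (s' * real t)" unfolding f_def split by (simp only: ac_simps)
    also have "\<dots> \<le> K * 4 powr (s' * real t)" using K(2)[of t] by (intro mult_right_mono) auto
    finally show ?thesis .
  qed
  then show thesis using that K(1) by blast
qed

lemma hausdorff_premeasure_nonzero:
  fixes S :: "real set"
  assumes S: "\<And>t0 \<alpha>. (\<And>t. t \<ge> t0 \<Longrightarrow> \<alpha> \<notin> near_approximants t) \<Longrightarrow> \<alpha> \<in> S"
    and s: "0 < s" "s < 1"
  shows "hausdorff_premeasure s 1 S \<noteq> 0"
proof
  assume null: "hausdorff_premeasure s 1 S = 0"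
  \<comment> \<open>The room above \<open>s\<close> absorbs the factor \<open>gap t\<close>; the
    room below 1 keeps \<open>4 powr s'\<close> under the branching \<open>4 - 2 / gap t\<close> for
    large \<open>t\<close>.\<close>
  define s' where "s' = (s + 1) / 2"
  have s': "s < s'" "s' < 1" using s unfolding s'_def by auto
  have "(\<lambda>t. 4 - 2 / real (gap t)) \<longlonglongrightarrow> 4 - 0"
    by (intro tendsto_intros tendsto_divide_0[OF tendsto_const] filterlim_compose[OF filterlim_real_sequentially gap_at_top]
        filterlim_at_top_imp_at_infinity)
  moreover have "4 powr s' < 4 powr (1::real)" using s' by (intro powr_less_mono) auto
  ultimately have "eventually (\<lambda>t. 4 powr s' < 4 - 2 / real (gap t)) sequentially"
    by (intro order_tendstoD(1)) auto
  then obtain t1 where t1: "\<And>t. t \<ge> t1 \<Longrightarrow> 4 powr s' < 4 - 2 / real (gap t)"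
    unfolding eventually_sequentially by blast
  define t0 where "t0 = max 20 t1"
  obtain K where K: "K > 0" "\<And>t. 4 * real (gap t) * 4 powr (s * real (Suc t)) \<le> K * 4 powr (s' * real t)"
    using linear_gap_absorbed[OF s'(1)] by blast
  \<comment> \<open>The bound \<open>1 / K\<close> yields \<open>few\<close>. The other bound forces
    every \<open>l i\<close> beyond \<open>t0\<close>, since a scale up to \<open>t0\<close> would
    be shared by at most \<open>1 / 2\<close> indices.\<close>
  define \<epsilon> where "\<epsilon> = min (1 / K) (4 powr (- (s * real t0)) / 2)"
  have \<epsilon>: "\<epsilon> > 0" "\<epsilon> \<le> 1 / K" "\<epsilon> \<le> 4 powr (- (s * real t0)) / 2" using K(1) unfolding \<epsilon>_def by auto
  obtain U and c :: "nat \<Rightarrow> real" and l :: "nat \<Rightarrow> nat" where U: "S \<subseteq> (\<Union>i. U i)" "\<And>i. U i \<subseteq> cball (c i) (1 / 4 ^ l i)"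
    and l: "\<And>t. finite {i. l i = t}" "\<And>t. real (card {i. l i = t}) \<le> \<epsilon> * 4 powr (s * real t)"
    using null_set_scaled_cover[OF s(1) less_imp_le[OF s(2)] null \<epsilon>(1)] by metis
  have late: "t0 < l i" for i
  proof (rule ccontr)
    assume "\<not> t0 < l i"
    then have "4 powr (s * real (l i)) \<le> 4 powr (s * real t0)" using s by (intro powr_mono mult_left_mono) auto
    have "{k. l k = l i} \<noteq> {}" by blast
    then have "card {k. l k = l i} \<noteq> 0" using l(1) by simp
    then have "1 \<le> real (card {k. l k = l i})" by linarith
    also have "\<dots> \<le> \<epsilon> * 4 powr (s * real (l i))" by (rule l(2))
    also have "\<dots> \<le> 4 powr (- (s * real t0)) / 2 * 4 powr (s * real t0)"
      using \<epsilon> \<open>4 powr (s * real (l i)) \<le> _\<close> by (intro mult_mono) auto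
    also have "\<dots> = 1 / 2" by (simp flip: powr_add)
    finally show False by simp
  qed
  have few: "4 * real (card {i. l i = Suc t}) * real (gap t) \<le> 4 powr (s' * real t)" for t
  proof -
    have "4 * real (card {i. l i = Suc t}) * real (gap t) \<le> 4 * (\<epsilon> * 4 powr (s * real (Suc t))) * real (gap t)"
      by (intro mult_right_mono mult_left_mono l(2)) auto
    also have "\<dots> = \<epsilon> * (4 * real (gap t) * 4 powr (s * real (Suc t)))" by (simp only: ac_simps)
    also have "\<dots> \<le> 1 / K * (K * 4 powr (s' * real t))" using \<epsilon> K(1) by (intro mult_mono[OF _ K(2)]) auto
    also have "\<dots> = 4 powr (s' * real t)" using K(1) by simp
    finally show ?thesis .
  qed
  have "survivors (forbidden t0 U l) t \<noteq> {}" for t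
    by (rule survivors_growth[of t0 s' U c l]) (use t1 s' U(2) late l(1) few in \<open>auto simp: t0_def less_imp_le\<close>)
  then obtain x where x: "\<And>t. x \<notin> forbidden t0 U l (Suc t)" using survivors_limit_point by blast
  have x': "x \<notin> forbidden t0 U l t" if "0 < t" for t using x[of "t - 1"] that by simp
  have "x \<notin> near_approximants t" if "t \<ge> t0" for t
    using x'[of "t + gap t"] gap_pos[of t] that unfolding forbidden_def by auto
  then have "x \<in> S" by (rule S)
  then obtain i where "x \<in> U i" using U(1) by blast
  then show False using x'[of "l i"] late[of i] unfolding forbidden_def by auto
qed

theorem theorem2:
  fixes d :: "nat \<Rightarrow> nat"
  assumes "\<And>n. n \<ge> 1 \<Longrightarrow> d n = 2 ^ (2 ^ n)"
  shows "hausdorff_dimension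
    {\<alpha>::real. liminf (\<lambda>q::nat. ereal (real q * ln (ln (real q)) * ln (ln (ln (real q)))
        * pseudo_abs d (int q) * dist_nearest_int (real q * \<alpha>))) > 0} = 1"
    (is "hausdorff_dimension ?S = 1")
proof (rule antisym[OF hausdorff_dimension_real_le_1])
  show "1 \<le> hausdorff_dimension ?S"
    unfolding hausdorff_dimension_def
  proof (rule Inf_greatest, clarify)
    fix s :: real assume s: "0 \<le> s" "hausdorff_measure s ?S = 0"
    have "1 \<le> s"
    proof (rule ccontr)
      assume "\<not> 1 \<le> s"
      \<comment> \<open>The exponent \<open>s\<close> may be 0, so the argument moves to a positive
        exponent that is still below 1.\<close>
      define s' where "s' = (s + 1) / 2"
      have s': "0 < s'" "s \<le> s'" "s' < 1" using s(1) \<open>\<not> 1 \<le> s\<close> unfolding s'_def by auto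
      have "hausdorff_premeasure s' 1 ?S \<le> hausdorff_premeasure s 1 ?S"
        using s(1) s' by (intro hausdorff_premeasure_antimono)
      also have "\<dots> \<le> hausdorff_measure s ?S" unfolding hausdorff_measure_def by (rule SUP_upper) simp
      finally have "hausdorff_premeasure s' 1 ?S = 0" using s(2) by simp
      moreover have "hausdorff_premeasure s' 1 ?S \<noteq> 0"
        by (rule hausdorff_premeasure_nonzero[OF _ s'(1,3)], rule CollectI, rule liminf_pos_of_avoids[OF assms])
      ultimately show False by blast
    qed
    then show "1 \<le> ennreal s" by simp
  qed
qed

end
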